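(* Let $k$ be a nonnegative integer and let $h \geq 2$ be an integer. Put $m = 2^{\lfloor \log_2 h \rfloor}(4k+3)$ and $n = \sum_{i=0}^{h} \binom{m}{i}$. Then \[\nu^\wedge(\mathbb{Z}_n, m, [0,h]) < \min\left\{n, \sum_{i=0}^{h}\binom{m}{i}\right\}.\]
   Context: $\mathbb{Z}_n$ denotes the additive cyclic group of order $n$, and $\lfloor x \rfloor$ is the greatest integer $\le x$. For a finite subset $A = \{a_1,\dots,a_m\}$ (with $m$ distinct elements) of an additive abelian group $G$ and an integer $h \ge 0$, define $[0,h]^\wedge A = \{\sum_{i=1}^m \lambda_i a_i : \lambda_i \in \{0,1\},\ \sum_{i=1}^m \lambda_i \in \{0,1,\dots,h\}\}$, i.e. the set of all sums of at most $h$ distinct elements of $A$ (the empty sum being $0$). For positive integers $m,h$, $\nu^\wedge(G,m,[0,h]) = \max\{|[0,h]^\wedge A| : A \subseteq G,\ |A| = m\}$. *)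

theory Defs
  imports Complex_Main "HOL-Algebra.FiniteProduct" "HOL-Algebra.Elementary_Groups"
begin

text \<open>Abelian groups are HOL-Algebra groups and hence written multiplicatively: the sum
  \<open>\<Sum> \<lambda>\<^sub>i a\<^sub>i\<close> is the \<open>finprod\<close> of the powers \<open>a [^] l a\<close>, with \<open>l\<close> the coefficient function.
  Intended for a finite subset \<open>A\<close> of the carrier of a commutative group.\<close>

definition restricted_sumset :: "('a, 'b) monoid_scheme \<Rightarrow> nat \<Rightarrow> 'a set \<Rightarrow> 'a set" where
  "restricted_sumset G h A =
     {(\<Otimes>\<^bsub>G\<^esub>a\<in>A. a [^]\<^bsub>G\<^esub> l a) | l :: 'a \<Rightarrow> nat.
        (\<forall>a\<in>A. l a \<in> {0, 1}) \<and> (\<Sum>a\<in>A. l a) \<in> {0..h}}"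

text \<open>The set under \<open>Max\<close> is always finite, its members being at most \<open>2 ^ m\<close>. It is nonempty
  exactly when \<open>G\<close> has an \<open>m\<close>-element subset; otherwise the value is unspecified.\<close>

definition restricted_nu :: "('a, 'b) monoid_scheme \<Rightarrow> nat \<Rightarrow> nat \<Rightarrow> nat" where
  "restricted_nu G m h =
     Max {card (restricted_sumset G h A) | A. A \<subseteq> carrier G \<and> finite A \<and> card A = m}"

end

theory Submission
  imports Defs "HOL-Computational_Algebra.Primes"
begin

text \<open>
  Equality would force \<open>S \<mapsto> \<Sum>S mod n\<close> to be a bijection from the subsets of \<open>A\<close> of size at most
  \<open>h\<close> onto the residues modulo \<open>n\<close>. Sum all the values. Since \<open>n \<equiv> 2 (mod 4)\<close>, the residues add up
  to the odd number \<open>n (n - 1) / 2\<close>. On the other side, as \<open>n\<close> is even, reduction modulo \<open>n\<close>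
  preserves parity, and each element of \<open>A\<close> is counted \<open>\<Sum>i<h. (m - 1 choose i)\<close> times, which is
  even. Both parities are read off from the alternating partial sums of a row of Pascal's triangle
  and from the 2-adic valuation of \<open>m - 1 choose h\<close>, which is \<open>1\<close>.
\<close>

section \<open>Partial row sums of Pascal's triangle modulo 2 and 4\<close>

text \<open>Pascal's rule makes the alternating sum telescope.\<close>

lemma alternating_binomial_partial_sum:
  "(\<Sum>i\<le>h. (- 1) ^ i * int (Suc N choose i)) = (- 1) ^ h * int (N choose h)"
  by (induction h) (auto simp: algebra_simps)

text \<open>Signs are invisible modulo 2, so the closed form of the alternating sum decides the
  parity.\<close>

lemma even_binomial_partial_sum_iff:
  "even (\<Sum>i\<le>h. Suc N choose i) \<longleftrightarrow> even (N choose h)"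
proof -
  have "even (\<Sum>i\<in>I. int (f i)) \<longleftrightarrow> even (\<Sum>i\<in>I. (- 1) ^ i * int (f i))"
    if "finite I" for I :: "nat set" and f
    using that by (induction I) (auto simp: minus_one_power_iff)
  from this[of "{..h}" "\<lambda>i. Suc N choose i"]
  have "even (int (\<Sum>i\<le>h. Suc N choose i)) \<longleftrightarrow> even ((- 1) ^ h * int (N choose h))"
    by (simp add: alternating_binomial_partial_sum)
  then show ?thesis
    by (simp only: even_of_nat even_mult_iff even_power even_minus odd_one) simp
qed

text \<open>Flipping the sign of a term changes the sum by twice that term. Only terms with odd
  \<open>i\<close> are flipped, and these are even because \<open>i * (Suc N choose i)\<close> is a
  multiple of the even number \<open>Suc N\<close>. The plain and the alternating sum therefore
  agree modulo 4.\<close>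

lemma four_dvd_binomial_partial_sum_iff:
  assumes "odd N"
  shows "4 dvd (\<Sum>i\<le>h. Suc N choose i) \<longleftrightarrow> 4 dvd (N choose h)"
proof -
  have "4 dvd (1 - (- 1) ^ i) * int (Suc N choose i)" for i
  proof (cases "even i")
    case False
    then obtain j where j: "i = Suc j" by (cases i) auto
    have "even (Suc N * (N choose j))" using assms by simp
    then have "even (Suc N choose i)"
      unfolding Suc_times_binomial[symmetric] using False j by simp
    then have "2 * 2 dvd 2 * int (Suc N choose i)"
      by (intro mult_dvd_mono) auto
    then show ?thesis using False by simp
  qed simp
  then have "4 dvd (\<Sum>i\<le>h. (1 - (- 1) ^ i) * int (Suc N choose i))"
    by (intro dvd_sum)
  then have d: "4 dvd int (\<Sum>i\<le>h. Suc N choose i) - (- 1) ^ h * int (N choose h)"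
    by (simp add: left_diff_distrib sum_subtractf alternating_binomial_partial_sum)
  have "4 dvd int (\<Sum>i\<le>h. Suc N choose i) \<longleftrightarrow> 4 dvd (- 1) ^ h * int (N choose h)"
    using d by (metis dvd_add_right_iff diff_add_cancel)
  also have "\<dots> \<longleftrightarrow> 4 dvd int (N choose h)"
    by (cases "even h") auto
  finally show ?thesis by presburger
qed

section \<open>2-adic valuation of binomial coefficients\<close>

text \<open>If the two multiplicities differed, that of the sum \<open>M\<close> would be the
  smaller one, hence below \<open>e\<close>.\<close>

lemma multiplicity_diff_eq:
  fixes p :: nat
  assumes "p ^ e dvd M" "j < M" "\<not> p ^ e dvd j"
  shows "multiplicity p (M - j) = multiplicity p j"
proof (rule ccontr)
  assume neq: "multiplicity p (M - j) \<noteq> multiplicity p j"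
  have nz: "j \<noteq> 0" "M - j \<noteq> 0" using assms by (auto intro: gr0I)
  have lt: "multiplicity p j < e" using assms(3) multiplicity_dvd'[of e p j] by (meson not_le)
  have M: "j + (M - j) = M" "M - j + j = M" using assms(2) by auto
  have "multiplicity p M \<le> multiplicity p j"
    using neq multiplicity_sum_lt[of p j "M - j"] multiplicity_sum_lt[of p "M - j" j] nz M
    by (cases "multiplicity p j < multiplicity p (M - j)") auto
  moreover have "e \<le> multiplicity p M"
    using assms nz by (intro multiplicity_geI) (auto simp: is_unit_power_iff)
  ultimately show False using lt by simp
qed

text \<open>Passing from \<open>i\<close> to \<open>Suc i\<close> multiplies the coefficient by
  \<open>(M - Suc i) / Suc i\<close>. This ratio has valuation 0, except at
  \<open>Suc i = 2 ^ e\<close>: there \<open>4 * k + 3 - 1\<close> is twice an odd number, which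
  contributes one extra factor 2.\<close>

lemma multiplicity_two_binomial:
  fixes e k :: nat
  defines "M \<equiv> 2 ^ e * (4 * k + 3)"
  assumes "i < 2 ^ Suc e"
  shows "multiplicity 2 (M - 1 choose i) = (if i < 2 ^ e then 0 else 1)"
  using assms(2)
proof (induction i)
  case (Suc i)
  let ?v = "multiplicity (2::nat)"
  have M: "2 ^ Suc e < M" by (simp add: M_def)
  \<comment> \<open>Multiplicities add up over products only when the factors are nonzero.\<close>
  have pos: "M - 1 choose i \<noteq> 0" "M - 1 choose Suc i \<noteq> 0" "M - Suc i \<noteq> 0"
    using M Suc.prems by auto
  have "Suc i * (M - 1 choose Suc i) = (M - Suc i) * (M - 1 choose i)"
    using M binomial_absorb_comp[of "M - 1" i] times_binomial_minus1_eq[of "Suc i" "M - 1"]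
    by simp
  then have "?v (Suc i * (M - 1 choose Suc i)) = ?v ((M - Suc i) * (M - 1 choose i))"
    by simp
  then have step: "?v (Suc i) + ?v (M - 1 choose Suc i) = ?v (M - Suc i) + ?v (M - 1 choose i)"
    using pos by (simp add: prime_elem_multiplicity_mult_distrib del: mult_Suc)
  show ?case
  proof (cases "Suc i = 2 ^ e")
    case True
    have "M - 2 ^ e = 2 ^ e * (4 * k + 2)"
      by (simp add: M_def algebra_simps)
    also have "\<dots> = 2 ^ Suc e * (2 * k + 1)" by simp
    finally have "?v (M - Suc i) = ?v (2 ^ Suc e * (2 * k + 1))" using True by simp
    also have "\<dots> = Suc e"
      by (subst prime_elem_multiplicity_mult_distrib)
         (auto simp del: power_Suc simp: not_dvd_imp_multiplicity_0)
    finally show ?thesis using step Suc True by simp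
  next
    case False
    have "\<not> 2 ^ e dvd Suc i"
    proof
      assume "2 ^ e dvd Suc i"
      then obtain q where q: "Suc i = 2 ^ e * q" by blast
      with Suc.prems have "q < 2" by simp
      with q False show False by (cases q) auto
    qed
    moreover have "2 ^ e dvd M" by (simp add: M_def)
    moreover have "Suc i < M" using M Suc.prems by linarith
    ultimately have "?v (M - Suc i) = ?v (Suc i)"
      by (intro multiplicity_diff_eq)
    then show ?thesis using step Suc False by simp
  qed
qed simp

section \<open>Counting subsets of bounded size\<close>

lemma card_subsets_card_le:
  assumes "finite B"
  shows "card {T. T \<subseteq> B \<and> card T \<le> j} = (\<Sum>i\<le>j. card B choose i)"
proof -
  have "{T. T \<subseteq> B \<and> card T \<le> j} = (\<Union>i\<le>j. {T. T \<subseteq> B \<and> card T = i})" by auto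
  also have "card \<dots> = (\<Sum>i\<le>j. card {T. T \<subseteq> B \<and> card T = i})"
    using assms by (intro card_UN_disjoint) auto
  finally show ?thesis using assms by (simp add: n_subsets)
qed

lemma card_subsets_card_le_containing:
  assumes "finite A" "a \<in> A"
  shows "card {S. S \<subseteq> A \<and> card S \<le> Suc j \<and> a \<in> S} = (\<Sum>i\<le>j. card A - 1 choose i)"
proof -
  have "bij_betw (insert a) {T. T \<subseteq> A - {a} \<and> card T \<le> j} {S. S \<subseteq> A \<and> card S \<le> Suc j \<and> a \<in> S}"
  proof (rule bij_betwI[where g = "\<lambda>S. S - {a}"])
    show "insert a \<in> {T. T \<subseteq> A - {a} \<and> card T \<le> j} \<rightarrow> {S. S \<subseteq> A \<and> card S \<le> Suc j \<and> a \<in> S}"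
      using assms by (auto simp: card_insert_if finite_subset)
  qed (use assms in \<open>auto simp: card_Diff_singleton finite_subset\<close>)
  from bij_betw_same_card[OF this] show ?thesis
    using assms by (simp add: card_subsets_card_le card_Diff_singleton)
qed

section \<open>Sumsets in the cyclic group as subset sums\<close>

lemma finprod_integer_mod_group:
  assumes "n > 0" "finite A"
  shows "(\<Otimes>\<^bsub>integer_mod_group n\<^esub>a\<in>A. a [^]\<^bsub>integer_mod_group n\<^esub> (l a :: nat))
    = (\<Sum>a\<in>A. int (l a) * a) mod int n"
proof -
  interpret comm_group "integer_mod_group n" by simp
  show ?thesis
    using assms(2)
  proof (induction A)
    case (insert x F)
    then show ?case
      using assms(1)
      \<comment> \<open>Each power is already reduced modulo \<open>n\<close>, which puts every
        factor in the carrier.\<close>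
      by (subst finprod_insert) (auto simp: carrier_integer_mod_group mod_simps Pi_def)
  qed simp
qed

text \<open>On \<open>A\<close>, a coefficient function with values 0 and 1 is the indicator of a
  subset, and its coefficient sum is the size of that subset.\<close>

lemma restricted_sumset_integer_mod_group:
  assumes "n > 0" "finite A"
  shows "restricted_sumset (integer_mod_group n) h A
    = (\<lambda>S. \<Sum>S mod int n) ` {S. S \<subseteq> A \<and> card S \<le> h}"
proof (intro equalityI subsetI)
  fix x assume "x \<in> restricted_sumset (integer_mod_group n) h A"
  then obtain l where l: "\<forall>a\<in>A. l a \<in> {0, 1}" "(\<Sum>a\<in>A. l a) \<le> h"
    and x: "x = (\<Sum>a\<in>A. int (l a) * a) mod int n"
    unfolding restricted_sumset_def using assms
    by (auto simp: finprod_integer_mod_group simp del: pow_integer_mod_group)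
  let ?S = "{a \<in> A. l a = 1}"
  have "(\<Sum>a\<in>A. l a) = (\<Sum>a\<in>A. if l a = 1 then 1 else 0)"
    using l by (intro sum.cong) auto
  then have "card ?S \<le> h"
    using l assms by (simp add: sum.If_cases Int_def)
  moreover have "(\<Sum>a\<in>A. int (l a) * a) = (\<Sum>a\<in>A. if l a = 1 then a else 0)"
    using l by (intro sum.cong) auto
  then have "x = \<Sum>?S mod int n"
    using x assms by (simp add: sum.If_cases Int_def)
  ultimately show "x \<in> (\<lambda>S. \<Sum>S mod int n) ` {S. S \<subseteq> A \<and> card S \<le> h}"
    by blast
next
  fix x assume "x \<in> (\<lambda>S. \<Sum>S mod int n) ` {S. S \<subseteq> A \<and> card S \<le> h}"
  then obtain S where S: "S \<subseteq> A" "card S \<le> h" and x: "x = \<Sum>S mod int n" by auto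
  define l :: "int \<Rightarrow> nat" where "l a = (if a \<in> S then 1 else 0)" for a
  have AS: "A \<inter> S = S" using S by auto
  have "(\<Sum>a\<in>A. l a) = card S"
    using assms AS by (simp add: l_def sum.If_cases)
  moreover have "(\<Sum>a\<in>A. int (l a) * a) = (\<Sum>a\<in>A. if a \<in> S then a else 0)"
    by (intro sum.cong) (auto simp: l_def)
  then have "(\<Sum>a\<in>A. int (l a) * a) = \<Sum>S"
    using assms AS by (simp add: sum.If_cases)
  ultimately show "x \<in> restricted_sumset (integer_mod_group n) h A"
    unfolding restricted_sumset_def using assms S x
    by (auto simp: finprod_integer_mod_group l_def intro!: exI[of _ l] simp del: pow_integer_mod_group)
qed

section \<open>Parity of the total of all subset sums\<close>

lemma even_sum_mod_iff:
  fixes f :: "'a \<Rightarrow> int"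
  assumes "even n"
  shows "even (\<Sum>x\<in>F. f x mod n) \<longleftrightarrow> even (\<Sum>x\<in>F. f x)"
proof -
  have "even (f x mod n) \<longleftrightarrow> even (f x)" for x
    using assms by (metis dvd_mod_iff)
  then show ?thesis by (induction F rule: infinite_finite_induct) auto
qed

text \<open>Double counting: each \<open>a\<close> contributes once for every admissible subset
  containing it, and that number does not depend on \<open>a\<close>.\<close>

lemma sum_sum_subsets_card_le:
  fixes A :: "'a::comm_semiring_1 set"
  assumes "finite A"
  shows "(\<Sum>S | S \<subseteq> A \<and> card S \<le> Suc j. \<Sum>S) = of_nat (\<Sum>i\<le>j. card A - 1 choose i) * \<Sum>A"
proof -
  let ?F = "{S. S \<subseteq> A \<and> card S \<le> Suc j}"
  have fin: "finite ?F" using assms by auto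
  have "(\<Sum>S\<in>?F. \<Sum>S) = (\<Sum>S\<in>?F. \<Sum>a\<in>A. if a \<in> S then a else 0)"
    proof (rule sum.cong)
    fix S assume "S \<in> ?F"
    then have "A \<inter> S = S" by auto
    then show "\<Sum>S = (\<Sum>a\<in>A. if a \<in> S then a else 0)"
      using sum.inter_restrict[OF assms, of "\<lambda>a. a" S] by simp
  qed simp
  also have "\<dots> = (\<Sum>a\<in>A. \<Sum>S\<in>?F. if a \<in> S then a else 0)"
    by (rule sum.swap)
  also have "\<dots> = (\<Sum>a\<in>A. of_nat (card {S. S \<subseteq> A \<and> card S \<le> Suc j \<and> a \<in> S}) * a)"
    using fin by (intro sum.cong) (auto simp: sum.If_cases Int_def conj_assoc)
  also have "\<dots> = (\<Sum>a\<in>A. of_nat (\<Sum>i\<le>j. card A - 1 choose i) * a)"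
    using assms by (intro sum.cong) (simp_all add: card_subsets_card_le_containing)
  finally show ?thesis by (simp add: sum_distrib_left)
qed

text \<open>Twice the sum is \<open>n * (n - 1)\<close>, which is then divisible by 4, while the odd
  factor \<open>n - 1\<close> is coprime to 4.\<close>

lemma even_sum_residues_imp_four_dvd:
  assumes "even n" "even (\<Sum>{0..<int n})"
  shows "4 dvd n"
proof -
  have "\<Sum>{0..<int n} = (\<Sum>i<n. int i)"
    by (rule sum.reindex_bij_witness[of _ int nat]) auto
  moreover have "2 * (\<Sum>i<n. int i) = int n * (int n - 1)"
    by (induction n) (auto simp: algebra_simps)
  ultimately have "2 * \<Sum>{0..<int n} = int n * (int n - 1)" by simp
  moreover have "2 * 2 dvd 2 * \<Sum>{0..<int n}"
    using assms by (intro mult_dvd_mono) auto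
  ultimately have "2 ^ 2 dvd int n * (int n - 1)" by simp
  moreover have "coprime (2 ^ 2) (int n - 1)"
    unfolding coprime_power_left_iff coprime_left_2_iff_odd using assms by simp
  ultimately have "2 ^ 2 dvd int n" using coprime_dvd_mult_left_iff by blast
  then have "4 dvd int n" by simp
  then show ?thesis by presburger
qed

text \<open>Isolates the parity argument: the special form of \<open>m\<close> enters only through
  the divisibility conditions on \<open>n\<close> and on the partial sum.\<close>

lemma card_restricted_sumset_less:
  assumes n: "n = (\<Sum>i\<le>Suc j. m choose i)" "even n" "\<not> 4 dvd n"
    and c: "even (\<Sum>i\<le>j. m - 1 choose i)"
    and A: "finite A" "card A = m"
  shows "card (restricted_sumset (integer_mod_group n) (Suc j) A) < n"
proof -
  let ?F = "{S. S \<subseteq> A \<and> card S \<le> Suc j}" and ?f = "\<lambda>S. \<Sum>S mod int n"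
  have n0: "n > 0" using n(3) by (auto intro: gr0I)
  have cF: "card ?F = n" using A n(1) by (simp only: card_subsets_card_le)
  have fF: "finite ?F" using A by auto
  have sub: "?f ` ?F \<subseteq> {0..<int n}" using n0 by auto
  have "card (?f ` ?F) \<noteq> n"
  proof
    assume eq: "card (?f ` ?F) = n"
    then have img: "?f ` ?F = {0..<int n}"
      using sub by (intro card_subset_eq) auto
    \<comment> \<open>The family \<open>?F\<close> has exactly \<open>n\<close> members, so an image
      of size \<open>n\<close> forces injectivity.\<close>
    have "inj_on ?f ?F" using eq cF fF by (intro eq_card_imp_inj_on) auto
    then have "\<Sum>{0..<int n} = (\<Sum>S\<in>?F. ?f S)"
      using sum.reindex[of ?f ?F "\<lambda>x. x"] img by simp
    moreover have "even (\<Sum>S\<in>?F. ?f S) \<longleftrightarrow> even (\<Sum>S\<in>?F. \<Sum>S)"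
      using n(2) by (intro even_sum_mod_iff) simp
    moreover have "even (\<Sum>S\<in>?F. \<Sum>S)"
      using c A by (simp only: sum_sum_subsets_card_le even_mult_iff even_of_nat simp_thms)
    ultimately have "4 dvd n" using n(2) even_sum_residues_imp_four_dvd by simp
    with n(3) show False by simp
  qed
  moreover have "card (?f ` ?F) \<le> n" using card_image_le[OF fF, of ?f] cF by simp
  ultimately show ?thesis
    using n0 A by (simp add: restricted_sumset_integer_mod_group)
qed

theorem theorem1p7:
  fixes k h m n :: nat
  assumes "h \<ge> 2"
    and "m = 2 ^ nat \<lfloor>log 2 (real h)\<rfloor> * (4 * k + 3)"
    and "n = (\<Sum>i=0..h. m choose i)"
  shows "restricted_nu (integer_mod_group n) m h < min n (\<Sum>i=0..h. m choose i)"
proof -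
  define e where "e = nat \<lfloor>log 2 (real h)\<rfloor>"
  have "\<lfloor>log 2 (real h)\<rfloor> = int e"
    using assms(1) by (simp add: e_def)
  \<comment> \<open>This puts \<open>h\<close> in the range where
    \<open>multiplicity_two_binomial\<close> yields valuation 1.\<close>
  then have h: "2 ^ e \<le> h" "h < 2 ^ Suc e"
    using floor_log_nat_eq_powr_iff[of 2 h e] assms(1) by auto
  then have e: "e > 0" using assms(1) by (cases e) auto
  have m: "m = 2 ^ e * (4 * k + 3)" using assms(2) by (simp add: e_def)
  then have "even m" using e by simp
  have "2 ^ e * 3 \<le> m" unfolding m by (intro mult_le_mono) auto
  then have "m > 2" using one_le_power[of "2::nat" e] by linarith
  define N where "N = m - 2"
  have N: "m = Suc (Suc N)" "even N" using \<open>even m\<close> \<open>m > 2\<close> by (auto simp: N_def)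
  obtain j where j: "h = Suc j" using assms(1) by (cases h) auto
  have n: "n = (\<Sum>i\<le>Suc j. m choose i)" using assms(3) j by (simp add: atLeast0AtMost)
  have "multiplicity 2 (Suc N choose h) = 1"
    using multiplicity_two_binomial[of h e k, folded m] h N(1) by simp
  \<comment> \<open>The multiplicity of 2 in 0 is 0 by convention, so the value 1 excludes a
    vanishing coefficient.\<close>
  then have two: "2 ^ i dvd (Suc N choose h) \<longleftrightarrow> i \<le> 1" for i
    by (cases "Suc N choose h = 0") (auto simp: power_dvd_iff_le_multiplicity)
  have "even (Suc N choose h)" "\<not> 4 dvd (Suc N choose h)"
    using two[of 1] two[of 2] by auto
  then have n2: "even n" "\<not> 4 dvd n"
    using even_binomial_partial_sum_iff[of "Suc N" h] four_dvd_binomial_partial_sum_iff[of "Suc N" h]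
      N n j by auto
  \<comment> \<open>Absorption turns \<open>Suc N * (N choose j)\<close> into
    \<open>h * (Suc N choose h)\<close>. As \<open>Suc N\<close> is odd, \<open>N choose j\<close>
    must be even.\<close>
  have "even (Suc N * (N choose j))"
    using \<open>even (Suc N choose h)\<close> j by (simp only: Suc_times_binomial[symmetric]) simp
  then have c: "even (\<Sum>i\<le>j. m - 1 choose i)"
    using N even_binomial_partial_sum_iff[where h = j and N = N] by simp
  let ?C = "{card (restricted_sumset (integer_mod_group n) h A) | A.
    A \<subseteq> carrier (integer_mod_group n) \<and> finite A \<and> card A = m}"
  have lt: "x < n" if "x \<in> ?C" for x
    using that card_restricted_sumset_less[OF n n2 c] j by auto
  \<comment> \<open>The term at \<open>i = 1\<close> shows \<open>m \<le> n\<close>, so the group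
    has an \<open>m\<close>-element subset and the maximum is taken over a nonempty set.\<close>
  have "m choose 1 \<le> n" unfolding n by (rule member_le_sum) auto
  then have "{0..<int m} \<subseteq> carrier (integer_mod_group n)"
    by (auto simp: carrier_integer_mod_group)
  then have "?C \<noteq> {}" by (auto intro!: exI[of _ "{0..<int m}"])
  moreover have "finite ?C" using lt by (intro finite_subset[of ?C "{..<n}"]) auto
  ultimately have "Max ?C < n" using lt by (subst Max_less_iff) auto
  then show ?thesis using assms(3) by (simp add: restricted_nu_def)
qed

end
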